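(* Let $G$ be a finite simple connected graph on at least three vertices that is not fractionally Hamiltonian. Then there exists a finite simple graph $H$ with $V(H)=V(G)$ and $E(G)\subseteq E(H)$ such that $H$ is chordal and $H$ is not Hamiltonian. In other words, every connected graph on at least three vertices that is not fractionally Hamiltonian has a non-Hamiltonian chordal spanning supergraph.
   Context: All graphs are finite and simple. A graph is Hamiltonian if it contains a cycle through all of its vertices. A graph is chordal if it has no induced cycle of length at least four. For a nonempty proper set $S\subsetneq V(G)$, let $\partial(S):=\{uv\in E(G): |\{u,v\}\cap S|=1\}$. For an edge weighting $f:E(G)\to\mathbb R$ and $F\subseteq E(G)$, write $f(F):=\sum_{e\in F}f(e)$. A fractional Hamiltonian cycle of $G$ is an edge weighting $f:E(G)\to[0,1]$ such that $f(E(G))=|V(G)|$ and $f(\partial(S))\ge 2$ for every nonempty proper set $S\subsetneq V(G)$. A graph is fractionally Hamiltonian if it has a fractional Hamiltonian cycle. *)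

theory Defs
  imports Complex_Main
begin

definition simple_graph :: "'a set \<Rightarrow> 'a set set \<Rightarrow> bool" where
  "simple_graph V E \<longleftrightarrow> finite V \<and> (\<forall>e\<in>E. e \<subseteq> V \<and> card e = 2)"

definition connected_graph :: "'a set \<Rightarrow> 'a set set \<Rightarrow> bool" where
  "connected_graph V E \<longleftrightarrow> V \<noteq> {} \<and> (\<forall>u\<in>V. \<forall>v\<in>V. (u, v) \<in> {(x, y). {x, y} \<in> E}\<^sup>*)"

(* A cycle is given by the list of its vertices in cyclic order, first vertex not repeated. *)
definition cycle_edges :: "'a list \<Rightarrow> 'a set set" where
  "cycle_edges c = {{c ! i, c ! (Suc i mod length c)} | i. i < length c}"

definition graph_cycle :: "'a set set \<Rightarrow> 'a list \<Rightarrow> bool" where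
  "graph_cycle E c \<longleftrightarrow> 3 \<le> length c \<and> distinct c \<and> cycle_edges c \<subseteq> E"

definition induced_cycle :: "'a set set \<Rightarrow> 'a list \<Rightarrow> bool" where
  "induced_cycle E c \<longleftrightarrow> graph_cycle E c \<and> {e \<in> E. e \<subseteq> set c} = cycle_edges c"

definition hamiltonian :: "'a set \<Rightarrow> 'a set set \<Rightarrow> bool" where
  "hamiltonian V E \<longleftrightarrow> (\<exists>c. graph_cycle E c \<and> set c = V)"

definition chordal :: "'a set set \<Rightarrow> bool" where
  "chordal E \<longleftrightarrow> \<not> (\<exists>c. induced_cycle E c \<and> 4 \<le> length c)"

definition edge_boundary :: "'a set set \<Rightarrow> 'a set \<Rightarrow> 'a set set" where
  "edge_boundary E S = {e \<in> E. card (e \<inter> S) = 1}"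

(* Only the values of f on E matter. *)
definition fractional_hamiltonian_cycle :: "'a set \<Rightarrow> 'a set set \<Rightarrow> ('a set \<Rightarrow> real) \<Rightarrow> bool" where
  "fractional_hamiltonian_cycle V E f \<longleftrightarrow>
     (\<forall>e\<in>E. 0 \<le> f e \<and> f e \<le> 1) \<and>
     (\<Sum>e\<in>E. f e) = real (card V) \<and>
     (\<forall>S. S \<noteq> {} \<and> S \<subset> V \<longrightarrow> 2 \<le> (\<Sum>e\<in>edge_boundary E S. f e))"

definition fractionally_hamiltonian :: "'a set \<Rightarrow> 'a set set \<Rightarrow> bool" where
  "fractionally_hamiltonian V E \<longleftrightarrow> (\<exists>f. fractional_hamiltonian_cycle V E f)"

end

theory Submission
  imports Defs "HOL-Library.Multiset"
begin

text \<open>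
  If the linear program defining fractional Hamiltonian cycles is infeasible, Farkas' lemma yields
  a multiset \<open>M\<close> of vertex sets and a number \<open>k\<close> such that every edge of the graph is cut by at
  most \<open>k\<close> members of \<open>M\<close>, while \<open>2 |M| > k |V|\<close>. All members may be taken to avoid a fixed root,
  and uncrossing makes \<open>M\<close> laminar. Let \<open>H\<close> join two vertices whenever at most \<open>k\<close> members of \<open>M\<close>
  separate them. A Hamiltonian cycle of \<open>H\<close> would cross every member of \<open>M\<close> at least twice, giving
  \<open>2 |M| \<le> k |V|\<close>. Separation by a laminar family is a tree metric, so on a cycle of \<open>H\<close> the two
  neighbours of a vertex farthest from the root are adjacent, and \<open>H\<close> is chordal.
\<close>

section \<open>Farkas' lemma with integral multipliers\<close>

text \<open>A pair \<open>(a, b)\<close> stands for the linear inequality \<open>b \<le> (\<Sum>j. a j * x j)\<close>.\<close>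

inductive_set consequences :: "(('j \<Rightarrow> int) \<times> int) set \<Rightarrow> (('j \<Rightarrow> int) \<times> int) set"
  for K where
  base: "c \<in> K \<Longrightarrow> c \<in> consequences K"
| add: "(a, b) \<in> consequences K \<Longrightarrow> (a', b') \<in> consequences K
    \<Longrightarrow> (\<lambda>j. a j + a' j, b + b') \<in> consequences K"

lemma consequences_scale:
  assumes "(a, b) \<in> consequences K" "0 < n"
  shows "(\<lambda>j. n * a j, n * b) \<in> consequences K"
proof -
  have "(\<lambda>j. int (Suc m) * a j, int (Suc m) * b) \<in> consequences K" for m
  proof (induction m)
    case (Suc m)
    show ?case
      using consequences.add[OF assms(1) Suc] by (simp add: algebra_simps)
  qed (use assms in simp)
  from this[of "nat n - 1"] show ?thesis
    using assms(2) by simp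
qed

lemma finite_sets_separated:
  fixes A B :: "'b::linorder set"
  assumes "finite A" "finite B" "\<And>a b. a \<in> A \<Longrightarrow> b \<in> B \<Longrightarrow> a \<le> b"
  shows "\<exists>t. (\<forall>a\<in>A. a \<le> t) \<and> (\<forall>b\<in>B. t \<le> b)"
proof (cases "A = {}")
  case True
  then show ?thesis
    using assms(2) by (cases "B = {}") (auto intro!: exI[of _ "Min B"])
next
  case False
  then show ?thesis
    using assms by (intro exI[of _ "Max A"]) auto
qed

text \<open>Fourier-Motzkin elimination, one variable per induction step. Since the coefficients are
  integers, cancelling a variable takes only positive integer multipliers.\<close>

theorem farkas_integral:
  fixes K :: "(('j \<Rightarrow> int) \<times> int) set"
  assumes "finite J" "finite K"
  shows "(\<exists>x :: 'j \<Rightarrow> real. \<forall>(a, b)\<in>K. of_int b \<le> (\<Sum>j\<in>J. of_int (a j) * x j))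
    \<or> (\<exists>(a, b)\<in>consequences K. (\<forall>j\<in>J. a j = 0) \<and> 0 < b)"
  using assms
proof (induction J arbitrary: K rule: finite_induct)
  case empty
  then show ?case
    by (cases "\<exists>(a, b)\<in>K. 0 < b") (fastforce intro: consequences.base)+
next
  case (insert i J)
  define P where "P = {c \<in> K. 0 < fst c i}"
  define N where "N = {c \<in> K. fst c i < 0}"
  define comb :: "(('j \<Rightarrow> int) \<times> int) \<Rightarrow> (('j \<Rightarrow> int) \<times> int) \<Rightarrow> (('j \<Rightarrow> int) \<times> int)"
    where "comb p q = (\<lambda>j. (- fst q i) * fst p j + fst p i * fst q j,
      (- fst q i) * snd p + fst p i * snd q)" for p q
  define K' where "K' = {c \<in> K. fst c i = 0} \<union> (\<lambda>(p, q). comb p q) ` (P \<times> N)"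
  have comb: "comb p q \<in> consequences K" if "p \<in> P" "q \<in> N" for p q
  proof -
    have "(fst p, snd p) \<in> consequences K" "(fst q, snd q) \<in> consequences K"
      using that by (auto simp: P_def N_def intro: consequences.base)
    then show ?thesis
      unfolding comb_def using that
      by (intro consequences.add consequences_scale) (auto simp: P_def N_def)
  qed
  \<comment> \<open>Zero coefficients at \<open>i\<close> persist under addition, so a certificate
    for \<open>J\<close> drawn from \<open>K'\<close> is also one for
    \<open>insert i J\<close>.\<close>
  have K': "fst c i = 0 \<and> c \<in> consequences K" if "c \<in> consequences K'" for c
    using that
  proof induction
    case (base c)
    then show ?case
      using comb by (auto simp: K'_def comb_def intro: consequences.base)
  next
    case (add a b a' b')
    then show ?case
      by (auto intro: consequences.add)
  qed
  have "finite K'"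
    using insert.prems by (simp add: K'_def P_def N_def)
  from insert.IH[OF this] show ?case
  proof
    assume "\<exists>(a, b)\<in>consequences K'. (\<forall>j\<in>J. a j = 0) \<and> 0 < b"
    then show ?thesis
      using K' by fastforce
  next
    assume "\<exists>x :: 'j \<Rightarrow> real. \<forall>(a, b)\<in>K'. of_int b \<le> (\<Sum>j\<in>J. of_int (a j) * x j)"
    then obtain x :: "'j \<Rightarrow> real"
      where x: "\<And>c. c \<in> K' \<Longrightarrow> of_int (snd c) \<le> (\<Sum>j\<in>J. of_int (fst c j) * x j)"
      by fastforce
    define s where "s c = (\<Sum>j\<in>J. of_int (fst c j) * x j)" for c :: "('j \<Rightarrow> int) \<times> int"
    \<comment> \<open>The value of coordinate \<open>i\<close> at which \<open>c\<close> becomes an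
      equality: a lower bound for \<open>c\<close> in \<open>P\<close>, an upper bound for
      \<open>c\<close> in \<open>N\<close>, where dividing by a negative coefficient reverses the
      inequality.\<close>
    define bound where "bound c = (of_int (snd c) - s c) / of_int (fst c i)"
      for c :: "('j \<Rightarrow> int) \<times> int"
    \<comment> \<open>This is the inequality \<open>comb p q\<close>, divided by the product of its
      two positive multipliers.\<close>
    have "bound p \<le> bound q" if "p \<in> P" "q \<in> N" for p q
    proof -
      define \<alpha> \<beta> where "\<alpha> = real_of_int (fst p i)" and "\<beta> = - real_of_int (fst q i)"
      have pos: "0 < \<alpha>" "0 < \<beta>"
        using that by (auto simp: \<alpha>_def \<beta>_def P_def N_def)
      have "comb p q \<in> K'"
        using that by (auto simp: K'_def)
      from x[OF this] have "\<beta> * of_int (snd p) + \<alpha> * of_int (snd q) \<le> \<beta> * s p + \<alpha> * s q"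
        by (simp add: comb_def s_def \<alpha>_def \<beta>_def sum_distrib_left algebra_simps
            sum.distrib sum_negf sum_subtractf)
      then have "(of_int (snd p) - s p) / \<alpha> \<le> - ((of_int (snd q) - s q) / \<beta>)"
        using pos by (simp add: field_simps)
      then show ?thesis
        by (simp add: bound_def \<alpha>_def \<beta>_def)
    qed
    moreover have "finite P" "finite N"
      using insert.prems by (simp_all add: P_def N_def)
    ultimately have "\<exists>t. (\<forall>l\<in>bound ` P. l \<le> t) \<and> (\<forall>u\<in>bound ` N. t \<le> u)"
      by (intro finite_sets_separated) auto
    then obtain t where t: "\<forall>p\<in>P. bound p \<le> t" "\<forall>q\<in>N. t \<le> bound q"
      by auto
    have "of_int (snd c) \<le> of_int (fst c i) * t + s c" if "c \<in> K" for c
    proof -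
      consider "fst c i = 0" | "c \<in> P" | "c \<in> N"
        using \<open>c \<in> K\<close> by (auto simp: P_def N_def) linarith
      then show ?thesis
      proof cases
        case 1
        then show ?thesis
          using x[of c] \<open>c \<in> K\<close> by (simp add: K'_def s_def)
      next
        case 2
        then have "bound c \<le> t" "0 < fst c i"
          using t(1) by (blast, simp add: P_def)
        then show ?thesis
          by (simp add: bound_def field_simps)
      next
        case 3
        then have "t \<le> bound c" "fst c i < 0"
          using t(2) by (blast, simp add: N_def)
        then show ?thesis
          by (simp add: bound_def field_simps)
      qed
    qed
    moreover have "(\<Sum>j\<in>insert i J. of_int (fst c j) * (x(i := t)) j) = of_int (fst c i) * t + s c"
      for c :: "('j \<Rightarrow> int) \<times> int"
    proof -
      have "(\<Sum>j\<in>J. of_int (fst c j) * (x(i := t)) j) = s c"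
        unfolding s_def using insert.hyps by (intro sum.cong) auto
      then show ?thesis
        using insert.hyps by simp
    qed
    ultimately show ?thesis
      by (intro disjI1 exI[of _ "x(i := t)"]) fastforce
  qed
qed

section \<open>Separation by multisets of vertex sets\<close>

text \<open>The cut pseudometric of \<open>M\<close>; repeated members count with
  multiplicity.\<close>

definition separation :: "'a set multiset \<Rightarrow> 'a \<Rightarrow> 'a \<Rightarrow> nat" where
  "separation M u v = size {#S \<in># M. (u \<in> S) \<noteq> (v \<in> S)#}"

lemma separation_simps [simp]:
  "separation {#} u v = 0"
  "separation (add_mset S M) u v = of_bool ((u \<in> S) \<noteq> (v \<in> S)) + separation M u v"
  "separation (M + N) u v = separation M u v + separation N u v"
  by (auto simp: separation_def)

lemma separation_commute: "separation M u v = separation M v u"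
  by (induction M) auto

definition threshold_graph :: "'a set \<Rightarrow> 'a set multiset \<Rightarrow> nat \<Rightarrow> 'a set set" where
  "threshold_graph V M k = {{u, v} | u v. u \<in> V \<and> v \<in> V \<and> u \<noteq> v \<and> separation M u v \<le> k}"

lemma threshold_graph_iff:
  "{u, v} \<in> threshold_graph V M k \<longleftrightarrow> u \<in> V \<and> v \<in> V \<and> u \<noteq> v \<and> separation M u v \<le> k"
  unfolding threshold_graph_def by (auto simp: doubleton_eq_iff separation_commute)

lemma simple_threshold_graph: "finite V \<Longrightarrow> simple_graph V (threshold_graph V M k)"
  by (auto simp: simple_graph_def threshold_graph_def)

text \<open>Without a descent, \<open>P\<close> would propagate from \<open>i\<close> all the way
  round; \<open>n - i + j\<close> steps lead from \<open>i\<close> to \<open>j\<close> modulo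
  \<open>n\<close>.\<close>

lemma cyclic_descent:
  fixes P :: "nat \<Rightarrow> bool"
  assumes "i < n" "P i" "j < n" "\<not> P j"
  shows "\<exists>m<n. P m \<and> \<not> P (Suc m mod n)"
proof (rule ccontr)
  assume contra: "\<not> ?thesis"
  have "P ((i + t) mod n)" for t
  proof (induction t)
    case (Suc t)
    then have "P (Suc ((i + t) mod n) mod n)"
      using contra assms(1) by auto
    then show ?case
      by (simp add: mod_Suc_eq)
  qed (use assms in simp)
  from this[of "n - i + j"] show False
    using assms by simp
qed

text \<open>A descent of \<open>P\<close> and a descent of its negation occur at different
  positions, since \<open>P\<close> holds at the first and fails at the second.\<close>

lemma cyclic_changes_ge_2:
  fixes P :: "nat \<Rightarrow> bool"
  assumes "i < n" "P i" "j < n" "\<not> P j"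
  shows "2 \<le> (\<Sum>m<n. of_bool (P m \<noteq> P (Suc m mod n)) :: nat)"
proof -
  obtain m where m: "m < n" "P m" "\<not> P (Suc m mod n)"
    using cyclic_descent[OF assms] by blast
  obtain m' where m': "m' < n" "\<not> P m'" "P (Suc m' mod n)"
    using cyclic_descent[of j n "\<lambda>i. \<not> P i" i] assms by blast
  have "m \<noteq> m'"
    using m m' by auto
  then have "2 = (\<Sum>l\<in>{m, m'}. of_bool (P l \<noteq> P (Suc l mod n)) :: nat)"
    using m m' by auto
  also have "\<dots> \<le> (\<Sum>l<n. of_bool (P l \<noteq> P (Suc l mod n)))"
    using m m' by (intro sum_mono2) auto
  finally show ?thesis .
qed

text \<open>Double counting: a member containing some but not all vertices of the cycle is both left
  and entered along it, so it contributes at least 2 to the sum.\<close>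

lemma separation_around_cycle:
  assumes "\<And>S. S \<in># M \<Longrightarrow> set c \<inter> S \<noteq> {} \<and> \<not> set c \<subseteq> S"
  shows "2 * size M \<le> (\<Sum>i<length c. separation M (c ! i) (c ! (Suc i mod length c)))"
  using assms
proof (induction M)
  case (add S M)
  obtain i j where "i < length c" "c ! i \<in> S" "j < length c" "c ! j \<notin> S"
    using add.prems[of S] by (auto simp: in_set_conv_nth)
  from cyclic_changes_ge_2[of i "length c" "\<lambda>i. c ! i \<in> S", OF this]
  show ?case
    using add by (simp add: sum.distrib)
qed simp

lemma not_hamiltonian_threshold_graph:
  assumes "\<And>S. S \<in># M \<Longrightarrow> S \<noteq> {} \<and> S \<subset> V"
    and "card V * k < 2 * size M"
  shows "\<not> hamiltonian V (threshold_graph V M k)"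
proof
  assume "hamiltonian V (threshold_graph V M k)"
  then obtain c where c: "graph_cycle (threshold_graph V M k) c" "set c = V"
    by (auto simp: hamiltonian_def)
  have "separation M (c ! i) (c ! (Suc i mod length c)) \<le> k" if "i < length c" for i
  proof -
    have "{c ! i, c ! (Suc i mod length c)} \<in> threshold_graph V M k"
      using c that by (auto simp: graph_cycle_def cycle_edges_def)
    then show ?thesis
      by (simp add: threshold_graph_iff)
  qed
  then have "(\<Sum>i<length c. separation M (c ! i) (c ! (Suc i mod length c))) \<le> length c * k"
    using sum_bounded_above[of "{..<length c}"
      "\<lambda>i. separation M (c ! i) (c ! (Suc i mod length c))" k] by simp
  moreover have "2 * size M \<le> (\<Sum>i<length c. separation M (c ! i) (c ! (Suc i mod length c)))"
    using assms(1) c(2) by (intro separation_around_cycle) blast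
  moreover have "length c = card V"
    using c distinct_card by (force simp: graph_cycle_def)
  ultimately show False
    using assms(2) by simp
qed

section \<open>Laminar families and chordality\<close>

definition laminar :: "'a set set \<Rightarrow> bool" where
  "laminar \<S> \<longleftrightarrow> (\<forall>S\<in>\<S>. \<forall>T\<in>\<S>. S \<inter> T = {} \<or> S \<subseteq> T \<or> T \<subseteq> S)"

text \<open>If all members avoid a root, this is the separation from the root; for laminar
  \<open>M\<close> it is the level of \<open>v\<close> in the containment forest.\<close>

definition depth :: "'a set multiset \<Rightarrow> 'a \<Rightarrow> nat" where
  "depth M v = size {#S \<in># M. v \<in> S#}"

text \<open>A member containing both vertices counts twice on each side, a member containing exactly
  one of them once. The number of common members is the Gromov product with respect to a root
  outside all members.\<close>

lemma separation_depth:
  "separation M u v + 2 * size {#S \<in># M. u \<in> S \<and> v \<in> S#} = depth M u + depth M v"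
  by (induction M) (auto simp: depth_def)

text \<open>By the first hypothesis \<open>b\<close> shares at least as many members with
  \<open>a\<close> as \<open>v\<close> does; in \<open>separation_depth\<close>, more common members
  and smaller depth both lower the separation from \<open>a\<close>.\<close>

lemma separation_le_of_depth:
  assumes "\<And>S. S \<in># M \<Longrightarrow> a \<in> S \<Longrightarrow> v \<in> S \<Longrightarrow> b \<in> S" and "depth M b \<le> depth M v"
  shows "separation M a b \<le> separation M a v"
proof -
  have "{#S \<in># M. a \<in> S \<and> v \<in> S#} \<subseteq># {#S \<in># M. a \<in> S \<and> b \<in> S#}"
    using assms(1) by (induction M) (auto intro: subset_mset.order_trans)
  then have "size {#S \<in># M. a \<in> S \<and> v \<in> S#} \<le> size {#S \<in># M. a \<in> S \<and> b \<in> S#}"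
    by (rule size_mset_mono)
  then show ?thesis
    using separation_depth[of M a b] separation_depth[of M a v] assms(2) by linarith
qed

text \<open>Within the chain of members containing \<open>v\<close>, those that also contain
  \<open>a\<close> and those that also contain \<open>b\<close> are upward closed, hence comparable
  by inclusion; either case fits \<open>separation_le_of_depth\<close>.\<close>

lemma laminar_separation_ultrametric:
  assumes "laminar (set_mset M)" "depth M a \<le> depth M v" "depth M b \<le> depth M v"
  shows "separation M a b \<le> max (separation M v a) (separation M v b)"
proof -
  text \<open>The members containing \<open>v\<close> form a chain.\<close>
  have "(\<forall>S\<in>#M. a \<in> S \<and> v \<in> S \<longrightarrow> b \<in> S) \<or> (\<forall>S\<in>#M. b \<in> S \<and> v \<in> S \<longrightarrow> a \<in> S)"
    using assms(1) unfolding laminar_def by blast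
  then show ?thesis
  proof
    assume "\<forall>S\<in>#M. a \<in> S \<and> v \<in> S \<longrightarrow> b \<in> S"
    then have "separation M a b \<le> separation M a v"
      using assms(3) by (intro separation_le_of_depth) auto
    then show ?thesis
      by (simp add: separation_commute[of M a v])
  next
    assume "\<forall>S\<in>#M. b \<in> S \<and> v \<in> S \<longrightarrow> a \<in> S"
    then have "separation M b a \<le> separation M b v"
      using assms(2) by (intro separation_le_of_depth) auto
    then show ?thesis
      by (simp add: separation_commute[of M b v] separation_commute[of M b a])
  qed
qed

lemma induced_cycle_neighbours:
  assumes "induced_cycle E c" "4 \<le> length c" "i < length c"
  shows "\<exists>a\<in>set c. \<exists>b\<in>set c. a \<noteq> b \<and> {c ! i, a} \<in> E \<and> {c ! i, b} \<in> E \<and> {a, b} \<notin> E"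
proof -
  define l where "l = length c"
  \<comment> \<open>Cyclic successor and predecessor of \<open>i\<close>.\<close>
  define p where "p = (if Suc i = l then 0 else Suc i)"
  define q where "q = (if i = 0 then l - 1 else i - 1)"
  have l: "4 \<le> l" "i < l" "p < l" "q < l" "p \<noteq> q" "p \<noteq> i" "q \<noteq> i"
    using assms(2,3) by (auto simp: l_def p_def q_def)
  have next_mod: "Suc j mod l = (if Suc j = l then 0 else Suc j)" if "j < l" for j
    using that by auto
  have c: "distinct c" "cycle_edges c \<subseteq> E" "{e \<in> E. e \<subseteq> set c} = cycle_edges c"
    using assms(1) by (auto simp: induced_cycle_def graph_cycle_def)
  have edge: "{c ! j, c ! (Suc j mod l)} \<in> E" if "j < l" for j
    using c(2) that by (auto simp: cycle_edges_def l_def)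
  have nth_eq: "c ! x = c ! y \<longleftrightarrow> x = y" if "x < l" "y < l" for x y
    using c(1) that by (simp add: nth_eq_iff_index_eq l_def)
  have "{c ! i, c ! p} \<in> E"
    using edge[of i] next_mod[of i] l by (simp add: p_def)
  moreover have "{c ! i, c ! q} \<in> E"
  proof -
    have "Suc q mod l = i"
      using next_mod[of q] l by (auto simp: q_def split: if_splits)
    then show ?thesis
      using edge[of q] l by (simp add: insert_commute)
  qed
  \<comment> \<open>An induced cycle has no chord, so \<open>p\<close> and \<open>q\<close> would be
    consecutive; on a cycle of length at least 4 the two neighbours of \<open>i\<close> are
    not.\<close>
  moreover have "{c ! p, c ! q} \<notin> E"
  proof
    assume "{c ! p, c ! q} \<in> E"
    then have "{c ! p, c ! q} \<in> cycle_edges c"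
      using c(3) l by (auto simp: l_def)
    then obtain j where j: "j < l" "{c ! p, c ! q} = {c ! j, c ! (Suc j mod l)}"
      by (auto simp: cycle_edges_def l_def)
    have "Suc j mod l < l"
      using l by simp
    with j l have "p = j \<and> q = Suc j mod l \<or> p = Suc j mod l \<and> q = j"
      by (auto simp: doubleton_eq_iff nth_eq)
    then show False
      using next_mod[OF j(1)] l j(1) by (auto simp: p_def q_def split: if_splits)
  qed
  ultimately show ?thesis
    using l nth_eq[of p q] by (intro bexI[of _ "c ! p"] bexI[of _ "c ! q"]) (auto simp: l_def)
qed

lemma chordal_threshold_graph:
  assumes "laminar (set_mset M)"
  shows "chordal (threshold_graph V M k)"
  unfolding chordal_def
proof
  assume "\<exists>c. induced_cycle (threshold_graph V M k) c \<and> 4 \<le> length c"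
  then obtain c where c: "induced_cycle (threshold_graph V M k) c" "4 \<le> length c"
    by blast
  have "finite (depth M ` set c)" "depth M ` set c \<noteq> {}"
    using c(2) by auto
  then have "Max (depth M ` set c) \<in> depth M ` set c"
    by (rule Max_in)
  then obtain v where v: "v \<in> set c" "Max (depth M ` set c) = depth M v"
    by auto
  then have deepest: "depth M w \<le> depth M v" if "w \<in> set c" for w
    using that by (metis Max_ge List.finite_set finite_imageI imageI)
  obtain i where i: "i < length c" "c ! i = v"
    using v(1) by (auto simp: in_set_conv_nth)
  obtain a b where ab: "a \<in> set c" "b \<in> set c" "a \<noteq> b"
    "{v, a} \<in> threshold_graph V M k" "{v, b} \<in> threshold_graph V M k"
    "{a, b} \<notin> threshold_graph V M k"
    using induced_cycle_neighbours[OF c i(1)] i(2) by blast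
  \<comment> \<open>Both separations from the deepest vertex \<open>v\<close> are at most
    \<open>k\<close>, hence so is that of \<open>a\<close> and \<open>b\<close>, which makes them
    adjacent.\<close>
  then show False
    using laminar_separation_ultrametric[OF assms deepest deepest, of a b]
    by (auto simp: threshold_graph_iff)
qed

section \<open>Uncrossing\<close>

text \<open>In terms of \<open>x\<close>, \<open>y\<close>, \<open>z\<close> below, the two sides
  differ by exactly \<open>2 * x * y\<close>, which is positive because neither set contains the
  other.\<close>

lemma card_squares_uncross:
  assumes "finite S" "finite T" "\<not> S \<subseteq> T" "\<not> T \<subseteq> S"
  shows "(card S)\<^sup>2 + (card T)\<^sup>2 < (card (S \<inter> T))\<^sup>2 + (card (S \<union> T))\<^sup>2"
proof -
  define x y z where "x = card (S - T)" and "y = card (T - S)" and "z = card (S \<inter> T)"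
  have "card S = x + z" "card T = y + z" "card (S \<union> T) = x + y + z"
    using assms(1,2) card_Int_Diff[of S T] card_Int_Diff[of T S] card_Un_disjoint[of "S - T" T]
    by (auto simp: x_def y_def z_def Int_commute)
  moreover have "0 < x * y"
    using assms by (auto simp: x_def y_def card_gt_0_iff)
  ultimately show ?thesis
    by (simp add: power2_eq_square algebra_simps z_def)
qed

text \<open>Among the \<open>good\<close> multisets, one with the largest sum of squared
  cardinalities is laminar: replacing a crossing pair by its intersection and union would increase
  that sum.\<close>

lemma uncross:
  assumes "finite U" "\<And>S. S \<in># M \<Longrightarrow> S \<noteq> {} \<and> S \<subseteq> U"
  obtains M' where "laminar (set_mset M')" "\<And>S. S \<in># M' \<Longrightarrow> S \<noteq> {} \<and> S \<subseteq> U"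
    "size M' = size M" "\<And>u v. separation M' u v \<le> separation M u v"
proof -
  define good where "good N \<longleftrightarrow> (\<forall>S\<in>#N. S \<noteq> {} \<and> S \<subseteq> U) \<and> size N = size M
    \<and> (\<forall>u v. separation N u v \<le> separation M u v)" for N
  define weight where "weight N = (\<Sum>S\<in>#N. (card S)\<^sup>2)" for N :: "'a set multiset"
  \<comment> \<open>A uniform bound, so that a maximum exists.\<close>
  have "weight N \<le> size N * (card U)\<^sup>2" if "\<forall>S\<in>#N. S \<subseteq> U" for N
    using that
  proof (induction N)
    case (add S N)
    then have "(card S)\<^sup>2 \<le> (card U)\<^sup>2"
      using assms(1) by (intro power_mono card_mono) auto
    then show ?case
      using add.IH add.prems by (auto simp: weight_def simp del: power2_nat_le_eq_le intro: add_mono)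
  qed (simp add: weight_def)
  then have "\<forall>N. good N \<longrightarrow> weight N < Suc (size M * (card U)\<^sup>2)"
    unfolding good_def by (fastforce simp: less_Suc_eq_le)
  moreover have "good M"
    using assms(2) by (simp add: good_def)
  ultimately have "\<exists>N. good N \<and> (\<forall>N'. good N' \<longrightarrow> weight N' \<le> weight N)"
    by (intro ex_has_greatest_nat)
  then obtain N where N: "good N" "\<And>N'. good N' \<Longrightarrow> weight N' \<le> weight N"
    by blast
  have "laminar (set_mset N)"
    unfolding laminar_def
  proof (intro ballI, rule ccontr)
    fix S T
    assume ST: "S \<in># N" "T \<in># N" "\<not> (S \<inter> T = {} \<or> S \<subseteq> T \<or> T \<subseteq> S)"
    obtain R' where R': "N = add_mset S R'"
      using multi_member_split[OF ST(1)] by blast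
    moreover have "S \<noteq> T"
      using ST(3) by blast
    ultimately have "T \<in># R'"
      using ST(2) by simp
    then obtain R where R: "N = add_mset S (add_mset T R)"
      using multi_member_split[of T R'] R' by blast
    define N' where "N' = add_mset (S \<inter> T) (add_mset (S \<union> T) R)"
    \<comment> \<open>The intersection and the union together separate any pair at most as often as
      \<open>S\<close> and \<open>T\<close> do.\<close>
    have "separation N' u v \<le> separation N u v" for u v
      by (auto simp: N'_def R)
    then have "separation N' u v \<le> separation M u v" for u v
      using N(1) order_trans unfolding good_def by blast
    moreover have ST_sub: "S \<subseteq> U" "T \<subseteq> U"
      using N(1) by (simp_all add: good_def R)
    then have "\<forall>S\<in>#N'. S \<noteq> {} \<and> S \<subseteq> U"
      using N(1) ST(3) by (auto simp: good_def N'_def R)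
    moreover have "size N' = size M"
      using N(1) by (simp add: good_def N'_def R)
    ultimately have "good N'"
      by (simp add: good_def)
    moreover have "finite S" "finite T"
      using ST_sub assms(1) finite_subset by blast+
    then have "weight N < weight N'"
      using ST(3) card_squares_uncross[of S T] by (simp add: weight_def N'_def R)
    ultimately show False
      using N(2) by (simp add: leD)
  qed
  then show thesis
    using N(1) that[of N] by (auto simp: good_def)
qed

section \<open>The dual of the fractional Hamiltonicity program\<close>

lemma card_doubleton_Int: "u \<noteq> v \<Longrightarrow> card ({u, v} \<inter> S) = 1 \<longleftrightarrow> (u \<in> S) \<noteq> (v \<in> S)"
  by (auto simp: Int_insert_left)

text \<open>Both ends of an edge lie in \<open>V\<close>, so exactly one is in \<open>S\<close> iff
  exactly one is outside. This reduces the cut constraints to sets avoiding a root.\<close>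

lemma edge_boundary_complement:
  assumes "simple_graph V E"
  shows "edge_boundary E (V - S) = edge_boundary E S"
proof -
  have "card (e \<inter> (V - S)) = 1 \<longleftrightarrow> card (e \<inter> S) = 1" if e: "e \<in> E" for e
  proof -
    obtain u v where "e = {u, v}" "u \<noteq> v" "u \<in> V" "v \<in> V"
      using assms e by (force simp: simple_graph_def card_2_iff)
    then show ?thesis
      using card_doubleton_Int[of u v] by auto
  qed
  then show ?thesis
    by (auto simp: edge_boundary_def)
qed

lemma edge_boundary_singleton: "edge_boundary E {v} = {e \<in> E. v \<in> e}"
  by (auto simp: edge_boundary_def Int_insert_right)

text \<open>The handshake identity turns the bound on the total into degree exactly 2 everywhere;
  the cut around the two ends of an edge then bounds its weight by 1.\<close>

lemma fractional_hamiltonian_cycleI: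
  fixes f :: "'a set \<Rightarrow> real"
  assumes G: "simple_graph V E" "3 \<le> card V"
    and nonneg: "\<And>e. e \<in> E \<Longrightarrow> 0 \<le> f e"
    and total: "(\<Sum>e\<in>E. f e) \<le> card V"
    and cut: "\<And>S. S \<noteq> {} \<Longrightarrow> S \<subseteq> V - {r} \<Longrightarrow> 2 \<le> (\<Sum>e\<in>edge_boundary E S. f e)"
  shows "fractional_hamiltonian_cycle V E f"
proof -
  have edges: "e \<subseteq> V" "card e = 2" if "e \<in> E" for e
    using G that by (auto simp: simple_graph_def)
  have fin: "finite V" "finite E"
    using G(1) finite_subset[of E "Pow V"] by (auto simp: simple_graph_def)
  have cut': "2 \<le> (\<Sum>e\<in>edge_boundary E S. f e)" if "S \<noteq> {}" "S \<subset> V" for S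
  proof (cases "r \<in> S")
    case True
    then have "2 \<le> (\<Sum>e\<in>edge_boundary E (V - S). f e)"
      using that by (intro cut) auto
    then show ?thesis
      by (simp add: edge_boundary_complement[OF G(1)])
  next
    case False
    then show ?thesis
      using that by (intro cut) auto
  qed
  define deg where "deg v = (\<Sum>e\<in>edge_boundary E {v}. f e)" for v
  have deg_ge: "2 \<le> deg v" if "v \<in> V" for v
    unfolding deg_def using that G(2) by (intro cut') auto
  have "(\<Sum>v\<in>V. deg v) = (\<Sum>v\<in>V. \<Sum>e\<in>E. if v \<in> e then f e else 0)"
    unfolding deg_def edge_boundary_singleton using fin by (simp add: sum.inter_filter)
  also have "\<dots> = (\<Sum>e\<in>E. \<Sum>v\<in>V. if v \<in> e then f e else 0)"
    by (rule sum.swap)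
  also have "\<dots> = (\<Sum>e\<in>E. 2 * f e)"
  proof (rule sum.cong[OF refl])
    fix e assume "e \<in> E"
    have "{v \<in> V. v \<in> e} = e"
      using edges[OF \<open>e \<in> E\<close>] by auto
    then have "(\<Sum>v\<in>V. if v \<in> e then f e else 0) = (\<Sum>v\<in>e. f e)"
      using fin by (simp flip: sum.inter_filter)
    then show "(\<Sum>v\<in>V. if v \<in> e then f e else 0) = 2 * f e"
      using edges[OF \<open>e \<in> E\<close>] by simp
  qed
  finally have deg_sum: "(\<Sum>v\<in>V. deg v) = 2 * (\<Sum>e\<in>E. f e)"
    by (simp add: sum_distrib_left)
  \<comment> \<open>The amounts by which the degrees exceed 2 are nonnegative and sum to at most 0,
    so all vanish.\<close>
  have excess: "(\<Sum>v\<in>V. deg v - 2) = 2 * (\<Sum>e\<in>E. f e) - 2 * card V"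
    using deg_sum by (simp add: sum_subtractf)
  moreover have "0 \<le> (\<Sum>v\<in>V. deg v - 2)"
    using deg_ge by (intro sum_nonneg) simp
  ultimately have total_eq: "(\<Sum>e\<in>E. f e) = card V"
    using total by simp
  then have "\<forall>v\<in>V. deg v - 2 = 0"
    using excess deg_ge fin by (subst sum_nonneg_eq_0_iff[symmetric]) auto
  then have deg_eq: "deg v = 2" if "v \<in> V" for v
    using that by simp
  have "f e \<le> 1" if eE: "e \<in> E" for e
  proof -
    obtain u v where e: "e = {u, v}" "u \<noteq> v"
      using edges(2)[OF eE] by (auto simp: card_2_iff)
    have uv: "u \<in> V" "v \<in> V"
      using edges(1)[OF eE] e by auto
    define A B where "A = edge_boundary E {u}" and "B = edge_boundary E {v}"
    have AB: "finite A" "finite B" "e \<in> A" "e \<in> B"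
      using fin eE e by (auto simp: A_def B_def edge_boundary_singleton)
    \<comment> \<open>As \<open>V\<close> has at least three vertices, \<open>e\<close> is a proper
      subset and its cut weighs at least 2. That weight is at most
      \<open>(deg u - f e) + (deg v - f e)\<close>, which is \<open>4 - 2 * f e\<close>.\<close>
    have "e \<noteq> V"
      using G(2) edges(2)[OF eE] by auto
    then have "2 \<le> (\<Sum>e'\<in>edge_boundary E e. f e')"
      using edges(1)[OF eE] e by (intro cut') auto
    also have "\<dots> \<le> (\<Sum>e'\<in>(A - {e}) \<union> (B - {e}). f e')"
    proof (rule sum_mono2)
      show "edge_boundary E e \<subseteq> (A - {e}) \<union> (B - {e})"
      proof
        fix e' assume e': "e' \<in> edge_boundary E e"
        then have "e' \<inter> e \<noteq> {}" "e' \<noteq> e" "e' \<in> E"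
          using edges(2)[OF eE] by (auto simp: edge_boundary_def)
        then show "e' \<in> (A - {e}) \<union> (B - {e})"
          using e by (auto simp: A_def B_def edge_boundary_singleton)
      qed
    qed (use AB nonneg in \<open>auto simp: A_def B_def edge_boundary_singleton\<close>)
    also have "\<dots> \<le> (\<Sum>e'\<in>A - {e}. f e') + (\<Sum>e'\<in>B - {e}. f e')"
    proof -
      have "0 \<le> (\<Sum>e'\<in>(A - {e}) \<inter> (B - {e}). f e')"
        using nonneg by (intro sum_nonneg) (auto simp: A_def edge_boundary_singleton)
      then show ?thesis
        using AB by (simp add: sum_Un)
    qed
    also have "\<dots> = (deg u - f e) + (deg v - f e)"
      using AB by (simp add: sum_diff1 deg_def A_def B_def)
    finally show ?thesis
      using deg_eq uv by simp
  qed
  then show ?thesis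
    using nonneg total_eq cut' by (simp add: fractional_hamiltonian_cycle_def)
qed

text \<open>From the Farkas multipliers, \<open>M\<close> collects the cuts with multiplicity and
  \<open>k\<close> counts the uses of the bound on the total. The constraints
  \<open>0 \<le> f e\<close> only add slack, whence an inequality for the separation.\<close>

lemma dual_of_not_fractionally_hamiltonian:
  fixes V :: "'a set"
  assumes G: "simple_graph V E" "3 \<le> card V" and not_fh: "\<not> fractionally_hamiltonian V E"
  obtains M k where "\<And>S. S \<in># M \<Longrightarrow> S \<noteq> {} \<and> S \<subseteq> V - {r}"
    "\<And>u v. {u, v} \<in> E \<Longrightarrow> separation M u v \<le> k" "card V * k < 2 * size M"
proof -
  have fin: "finite V" "finite E"
    using G(1) finite_subset[of E "Pow V"] by (auto simp: simple_graph_def)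
  define \<S> where "\<S> = {S. S \<noteq> {} \<and> S \<subseteq> V - {r}}"
  \<comment> \<open>The hypotheses of \<open>fractional_hamiltonian_cycleI\<close> as pairs; the
    upper bound on the total is negated into a lower bound.\<close>
  define nonneg where "nonneg d = (\<lambda>e. of_bool (e = d) :: int, 0 :: int)" for d :: "'a set"
  define cut where "cut S = (\<lambda>e. of_bool (e \<in> edge_boundary E S) :: int, 2 :: int)" for S
  define total where "total = (\<lambda>e :: 'a set. - 1 :: int, - int (card V))"
  define K where "K = nonneg ` E \<union> cut ` \<S> \<union> {total}"
  have "finite \<S>"
    using fin by (auto simp: \<S>_def intro: finite_subset[of _ "Pow V"])
  then have "finite K"
    using fin by (simp add: K_def)
  have "\<not> (\<exists>f :: 'a set \<Rightarrow> real. \<forall>(a, b)\<in>K. of_int b \<le> (\<Sum>e\<in>E. of_int (a e) * f e))"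
  proof
    assume "\<exists>f :: 'a set \<Rightarrow> real. \<forall>(a, b)\<in>K. of_int b \<le> (\<Sum>e\<in>E. of_int (a e) * f e)"
    then obtain f :: "'a set \<Rightarrow> real"
      where f: "\<And>a b. (a, b) \<in> K \<Longrightarrow> of_int b \<le> (\<Sum>e\<in>E. of_int (a e) * f e)"
      by blast
    have "fractional_hamiltonian_cycle V E f"
    proof (rule fractional_hamiltonian_cycleI[OF G])
      fix e assume "e \<in> E"
      then have "nonneg e \<in> K"
        by (simp add: K_def)
      then show "0 \<le> f e"
        using f[of "fst (nonneg e)" "snd (nonneg e)"] fin \<open>e \<in> E\<close>
        by (simp add: nonneg_def of_bool_def if_distrib if_distribR cong: if_cong)
    next
      have "total \<in> K"
        by (simp add: K_def)
      then show "(\<Sum>e\<in>E. f e) \<le> card V"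
        using f[of "fst total" "snd total"] by (simp add: total_def sum_negf)
    next
      fix S assume "S \<noteq> {}" "S \<subseteq> V - {r}"
      then have "cut S \<in> K"
        by (simp add: K_def \<S>_def)
      then have "2 \<le> (\<Sum>e\<in>E. of_bool (e \<in> edge_boundary E S) * f e)"
        using f[of "fst (cut S)" "snd (cut S)"] by (simp add: cut_def)
      also have "\<dots> = (\<Sum>e\<in>E. if e \<in> edge_boundary E S then f e else 0)"
        by (intro sum.cong) auto
      also have "\<dots> = (\<Sum>e\<in>edge_boundary E S. f e)"
        using fin by (simp add: edge_boundary_def flip: sum.inter_filter)
      finally show "2 \<le> (\<Sum>e\<in>edge_boundary E S. f e)" .
    qed
    then show False
      using not_fh by (auto simp: fractionally_hamiltonian_def)
  qed
  then obtain a b where ab: "(a, b) \<in> consequences K" "\<forall>e\<in>E. a e = 0" "0 < b"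
    using farkas_integral[OF fin(2) \<open>finite K\<close>] by blast
  \<comment> \<open>Invariant of summation: at an edge, cuts raise the coefficient by the
    separation, each use of \<open>total\<close> lowers it by 1, and \<open>nonneg\<close> terms can
    only raise it. The right-hand side is tracked exactly.\<close>
  have "\<exists>M k. (\<forall>S\<in>#M. S \<in> \<S>) \<and> (\<forall>u v. {u, v} \<in> E \<longrightarrow> int (separation M u v) \<le> fst c {u, v} + int k)
    \<and> snd c = 2 * int (size M) - int (card V * k)" if "c \<in> consequences K" for c
    using that
  proof induction
    case (base c)
    then consider d where "c = nonneg d" | S where "S \<in> \<S>" "c = cut S" | "c = total"
      by (auto simp: K_def)
    then show ?case
    proof cases
      case 1
      then show ?thesis
        by (intro exI[of _ "{#}"] exI[of _ 0]) (simp add: nonneg_def)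
    next
      case 2
      have "(u \<in> S) \<noteq> (v \<in> S) \<longrightarrow> {u, v} \<in> edge_boundary E S" if "{u, v} \<in> E" for u v
        using that card_doubleton_Int[of u v S] by (cases "u = v") (auto simp: edge_boundary_def)
      then show ?thesis
        using 2 by (intro exI[of _ "{#S#}"] exI[of _ 0]) (auto simp: cut_def)
    next
      case 3
      then show ?thesis
        by (intro exI[of _ "{#}"] exI[of _ 1]) (simp add: total_def)
    qed
  next
    case (add a b a' b')
    then obtain M k M' k'
      where "\<forall>S\<in>#M. S \<in> \<S>" "\<forall>S\<in>#M'. S \<in> \<S>"
        and sep: "\<And>u v. {u, v} \<in> E \<Longrightarrow> int (separation M u v) \<le> a {u, v} + int k"
          "\<And>u v. {u, v} \<in> E \<Longrightarrow> int (separation M' u v) \<le> a' {u, v} + int k'"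
        and "b = 2 * int (size M) - int (card V * k)" "b' = 2 * int (size M') - int (card V * k')"
      by auto
    moreover have "int (separation (M + M') u v) \<le> a {u, v} + a' {u, v} + int (k + k')"
      if "{u, v} \<in> E" for u v
      using sep[OF that] by simp
    ultimately show ?case
      by (intro exI[of _ "M + M'"] exI[of _ "k + k'"]) (auto simp: algebra_simps)
  qed
  from this[OF ab(1)] obtain M k where M: "\<forall>S\<in>#M. S \<in> \<S>"
      "\<forall>u v. {u, v} \<in> E \<longrightarrow> int (separation M u v) \<le> a {u, v} + int k"
      "b = 2 * int (size M) - int (card V * k)"
    by auto
  show thesis
  proof (rule that)
    show "S \<noteq> {} \<and> S \<subseteq> V - {r}" if "S \<in># M" for S
      using M(1) that by (simp add: \<S>_def)
    show "separation M u v \<le> k" if "{u, v} \<in> E" for u v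
      using M(2) ab(2) that by fastforce
    show "card V * k < 2 * size M"
      using M(3) ab(3) by linarith
  qed
qed

section \<open>The threshold graph of an uncrossed dual solution\<close>

theorem theorem1:
  fixes V :: "'a set" and E :: "'a set set"
  assumes "simple_graph V E"
    and "connected_graph V E"
    and "3 \<le> card V"
    and "\<not> fractionally_hamiltonian V E"
  shows "\<exists>F. simple_graph V F \<and> E \<subseteq> F \<and> chordal F \<and> \<not> hamiltonian V F"
proof -
  obtain r where "r \<in> V"
    using assms(3) by fastforce
  obtain M k where M: "\<And>S. S \<in># M \<Longrightarrow> S \<noteq> {} \<and> S \<subseteq> V - {r}"
      "\<And>u v. {u, v} \<in> E \<Longrightarrow> separation M u v \<le> k" "card V * k < 2 * size M"
    using dual_of_not_fractionally_hamiltonian[OF assms(1,3,4)] by metis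
  have fin: "finite V"
    using assms(1) by (simp add: simple_graph_def)
  \<comment> \<open>Uncrossing preserves the size and increases no separation, so the edge bound
    \<open>k\<close> and the strict inequality on sizes carry over to \<open>N\<close>.\<close>
  obtain N where N: "laminar (set_mset N)" "\<And>S. S \<in># N \<Longrightarrow> S \<noteq> {} \<and> S \<subseteq> V - {r}"
      "size N = size M" "\<And>u v. separation N u v \<le> separation M u v"
    using uncross[of "V - {r}" M] fin M(1) by (metis finite_Diff)
  have "E \<subseteq> threshold_graph V N k"
  proof
    fix e assume "e \<in> E"
    then obtain u v where "e = {u, v}" "u \<noteq> v" "u \<in> V" "v \<in> V"
      using assms(1) by (force simp: simple_graph_def card_2_iff)
    then show "e \<in> threshold_graph V N k"
      using M(2)[of u v] N(4)[of u v] \<open>e \<in> E\<close> by (simp add: threshold_graph_iff)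
  qed
  \<comment> \<open>Avoiding \<open>r\<close> makes every member of \<open>N\<close> a proper subset
    of \<open>V\<close>.\<close>
  moreover have "\<not> hamiltonian V (threshold_graph V N k)"
    using N(2,3) M(3) \<open>r \<in> V\<close> by (intro not_hamiltonian_threshold_graph) auto
  ultimately show ?thesis
    using simple_threshold_graph[OF fin] chordal_threshold_graph[OF N(1)] by blast
qed

end
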